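(* For every (finite) tree $T$, all roots of the subtree polynomial $\Phi_T$ lie in the disk $D=\{z\in\mathbb{C}\colon |z|\leq 1+\sqrt[3]{3}\}$. Moreover, $K_{1,3}$ is the only tree (up to isomorphism) whose subtree polynomial has a root on the boundary $\{z\in\mathbb{C}\colon |z|=1+\sqrt[3]{3}\}$ of $D$.
   Context: For a finite tree $T$ of order $n$, $s_k(T)$ denotes the number of subtrees (connected induced subgraphs) of $T$ of order $k$, and the subtree polynomial of $T$ is $\Phi_T(x)=\sum_{k=1}^n s_k(T)x^k$. $K_{1,3}$ is the star with one center and three leaves. *)

theory Defs
  imports Complex_Main "HOL-Computational_Algebra.Polynomial" "Graph_Theory.Graph_Theory"
begin

text \<open>
  Finite simple graphs are the symmetric digraphs of the locale \<^locale>\<open>graph\<close>.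
  The predicate \<^const>\<open>tree\<close> is not usable for them: in a symmetric digraph the two
  arcs of an edge already form a \<^const>\<open>pre_digraph.cycle\<close>. The cycles of the
  underlying undirected graph are the directed cycles of length at least 3.
\<close>

definition undirected_tree :: "('a, 'b) pre_digraph \<Rightarrow> bool" where
  "undirected_tree T \<longleftrightarrow> graph T \<and> Digraph_Component.connected T \<and>
     (\<nexists>p. pre_digraph.cycle T p \<and> length p \<ge> 3)"

text \<open>
  \<^const>\<open>Digraph_Component.connected\<close> excludes the empty graph, both for trees and for subtrees.
\<close>

definition subtree_count :: "('a, 'b) pre_digraph \<Rightarrow> nat \<Rightarrow> nat" where
  "subtree_count T k =
     card {S. induced_subgraph S T \<and> Digraph_Component.connected S \<and> card (verts S) = k}"

definition subtree_poly :: "('a, 'b) pre_digraph \<Rightarrow> complex poly" where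
  "subtree_poly T = (\<Sum>k = 1..card (verts T). monom (of_nat (subtree_count T k)) k)"

end

theory Submission
  imports Defs
begin

text \<open>
  Root the tree at a vertex \<open>r\<close>, and write \<open>\<Phi> = f + g\<close>, where \<open>f\<close> counts the subtrees containing \<open>r\<close>
  and \<open>g\<close> those avoiding it. Cutting an edge \<open>rb\<close> splits the tree into parts \<open>A \<ni> r\<close> and \<open>B \<ni> b\<close> with
  \<open>f = f\<^sub>A (1 + f\<^sub>B)\<close> and \<open>g = g\<^sub>A + f\<^sub>B + g\<^sub>B\<close>. Let \<open>|z| = R \<ge> 1 + \<gamma>\<close> with \<open>\<gamma>\<^sup>3 = 3\<close> and \<open>q = R - 1\<close>.
  Every branch \<open>B\<close> with at least two vertices satisfies \<open>|f\<^sub>B| + |g\<^sub>B| \<le> R (|f\<^sub>B| - 1)\<close>, while a leaf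
  contributes \<open>R\<close> to the bound on \<open>g\<close> and a factor at least \<open>q\<close> to \<open>f\<close>. Hence, if \<open>r\<close> has \<open>m\<close> leaf
  children and the other branches have weights \<open>a\<^sub>i = |f\<^sub>i| - 1 \<ge> 5/2\<close>, then \<open>|g| \<le> |f|\<close> follows from
  \<open>m + \<Sum> a\<^sub>i \<le> q\<^sup>m \<Prod> a\<^sub>i\<close>. The only tight cases are \<open>m = 3\<close>, \<open>q = \<gamma>\<close> without other branches,
  and a single branch which is itself tight; both are the tree \<open>K\<^sub>1\<^sub>,\<^sub>3\<close>, rooted at its centre or at a leaf.
\<close>

section \<open>Connected vertex sets\<close>

text \<open>The empty set passes vacuously, so \<open>subtrees\<close> excludes it
  separately.\<close>

definition conn_on :: "('a \<times> 'a) set \<Rightarrow> 'a set \<Rightarrow> bool" where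
  "conn_on E S \<longleftrightarrow> (\<forall>u\<in>S. \<forall>v\<in>S. (u, v) \<in> (Restr E S)\<^sup>*)"

definition subtrees :: "('a \<times> 'a) set \<Rightarrow> 'a set \<Rightarrow> 'a set set" where
  "subtrees E V = {S. S \<subseteq> V \<and> S \<noteq> {} \<and> conn_on E S}"

definition rooted_sum :: "('a \<times> 'a) set \<Rightarrow> 'a set \<Rightarrow> 'a \<Rightarrow> complex \<Rightarrow> complex" where
  "rooted_sum E V r z = (\<Sum>S | S \<in> subtrees E V \<and> r \<in> S. z ^ card S)"

definition avoiding_sum :: "('a \<times> 'a) set \<Rightarrow> 'a set \<Rightarrow> 'a \<Rightarrow> complex \<Rightarrow> complex" where
  "avoiding_sum E V r z = (\<Sum>S | S \<in> subtrees E V \<and> r \<notin> S. z ^ card S)"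

text \<open>Distinct neighbours of a vertex lie in different components once that vertex is removed;
  for symmetric irreflexive relations this says that there is no cycle of length at least 3.\<close>

definition forest_rel :: "('a \<times> 'a) set \<Rightarrow> bool" where
  "forest_rel E \<longleftrightarrow> sym E \<and> irrefl E \<and>
     (\<forall>r v w. (r, v) \<in> E \<longrightarrow> (r, w) \<in> E \<longrightarrow> v \<noteq> w \<longrightarrow> (v, w) \<notin> (Restr E (- {r}))\<^sup>*)"

text \<open>For a connected loopless \<open>V\<close> containing \<open>c\<close> this makes
  \<open>c\<close> the centre of a star. A single vertex and a single edge are included as stars
  with zero and one leaf.\<close>

definition star_on :: "('a \<times> 'a) set \<Rightarrow> 'a set \<Rightarrow> 'a \<Rightarrow> bool" where
  "star_on E V c \<longleftrightarrow> (\<forall>x\<in>V. \<forall>y\<in>V. (x, y) \<in> E \<longrightarrow> x = c \<or> y = c)"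

lemma finite_subtrees: "finite V \<Longrightarrow> finite (subtrees E V)"
  unfolding subtrees_def by simp

lemma sum_subtrees:
  assumes "finite V"
  shows "(\<Sum>S\<in>subtrees E V. z ^ card S) = rooted_sum E V r z + avoiding_sum E V r z"
proof -
  have "subtrees E V = {S. S \<in> subtrees E V \<and> r \<in> S} \<union> {S. S \<in> subtrees E V \<and> r \<notin> S}"
    by auto
  then have "(\<Sum>S\<in>subtrees E V. z ^ card S) =
      (\<Sum>S\<in>{S. S \<in> subtrees E V \<and> r \<in> S} \<union> {S. S \<in> subtrees E V \<and> r \<notin> S}. z ^ card S)"
    by simp
  also have "\<dots> = rooted_sum E V r z + avoiding_sum E V r z"
    unfolding rooted_sum_def avoiding_sum_def
    by (rule sum.union_disjoint) (auto simp: finite_subtrees assms)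
  finally show ?thesis .
qed

lemma conn_onI_root:
  assumes "sym E" "r \<in> S" and reach: "\<And>x. x \<in> S \<Longrightarrow> (x, r) \<in> (Restr E S)\<^sup>*"
  shows "conn_on E S"
proof -
  have "sym ((Restr E S)\<^sup>*)"
    using assms(1) by (intro sym_rtrancl) (auto simp: sym_def)
  then show ?thesis
    unfolding conn_on_def using reach by (meson rtrancl_trans symD)
qed

lemma conn_on_singleton: "conn_on E {r}"
  by (simp add: conn_on_def)

lemma subtrees_singleton: "subtrees E {r} = {{r}}"
  by (auto simp: subtrees_def conn_on_singleton)

lemma rooted_sum_singleton: "rooted_sum E {r} r z = z"
proof -
  have "{S. S \<in> subtrees E {r} \<and> r \<in> S} = {{r}}" by (auto simp: subtrees_singleton)
  then show ?thesis by (simp add: rooted_sum_def)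
qed

lemma avoiding_sum_singleton: "avoiding_sum E {r} r z = 0"
proof -
  have "{S. S \<in> subtrees E {r} \<and> r \<notin> S} = {}" by (auto simp: subtrees_singleton)
  then show ?thesis unfolding avoiding_sum_def by (simp only: sum.empty)
qed

section \<open>Splitting along an edge\<close>

text \<open>The situation after cutting the edge \<open>ab\<close> of a tree. The conditions are
  symmetric in the two sides, so every fact about \<open>A\<close> transfers to \<open>B\<close>
  through \<open>swap\<close>.\<close>

locale edge_split =
  fixes E :: "('a \<times> 'a) set" and A B :: "'a set" and a b :: 'a
  assumes sym: "sym E" and disj: "A \<inter> B = {}" and a: "a \<in> A" and b: "b \<in> B"
    and ab: "(a, b) \<in> E"
    and cross: "\<And>x y. x \<in> A \<Longrightarrow> y \<in> B \<Longrightarrow> (x, y) \<in> E \<Longrightarrow> x = a \<and> y = b"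
begin

lemma swap: "edge_split E B A b a"
proof
  show "sym E" "B \<inter> A = {}" "b \<in> B" "a \<in> A" "(b, a) \<in> E"
    using sym disj a b symD[OF sym ab] by auto
  show "x = b \<and> y = a" if "x \<in> B" "y \<in> A" "(x, y) \<in> E" for x y
    using cross[OF that(2,1) symD[OF sym that(3)]] by simp
qed

text \<open>A walk can leave \<open>A\<close> only from \<open>a\<close>, so a walk towards
  \<open>a\<close> may be stopped at its first departure from \<open>A\<close>.\<close>

lemma conn_on_side:
  assumes conn: "conn_on E S" and S: "S \<subseteq> A \<union> B" "a \<in> S"
  shows "conn_on E (S \<inter> A)"
proof (rule conn_onI_root[OF sym])
  show "a \<in> S \<inter> A" using S a by simp
  fix x assume x: "x \<in> S \<inter> A"
  then have "(x, a) \<in> (Restr E S)\<^sup>*" using conn S by (auto simp: conn_on_def)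
  then have "x \<in> A \<longrightarrow> (x, a) \<in> (Restr E (S \<inter> A))\<^sup>*"
  proof (induction rule: converse_rtrancl_induct)
    case (step y w)
    show ?case
    proof
      assume y: "y \<in> A"
      show "(y, a) \<in> (Restr E (S \<inter> A))\<^sup>*"
      proof (cases "w \<in> A")
        case True
        then have "(y, w) \<in> Restr E (S \<inter> A)" using step.hyps y by auto
        then show ?thesis using step.IH True by (meson converse_rtrancl_into_rtrancl)
      next
        case False
        then have "w \<in> B" using step.hyps S by auto
        then have "y = a" using cross step.hyps y by auto
        then show ?thesis by simp
      qed
    qed
  qed simp
  then show "(x, a) \<in> (Restr E (S \<inter> A))\<^sup>*" using x by simp
qed

text \<open>A walk from \<open>x\<close> to \<open>y\<close> inside \<open>S\<close> must step from
  \<open>A\<close> to \<open>B\<close>, and the only such step is \<open>ab\<close>.\<close>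

lemma conn_on_crossing:
  assumes conn: "conn_on E S" and S: "S \<subseteq> A \<union> B" and x: "x \<in> S" "x \<in> A" and y: "y \<in> S" "y \<in> B"
  shows "a \<in> S \<and> b \<in> S"
proof (rule ccontr)
  assume no: "\<not> (a \<in> S \<and> b \<in> S)"
  have "(x, y) \<in> (Restr E S)\<^sup>*" using conn x y by (auto simp: conn_on_def)
  then have "y \<in> A"
  proof (induction rule: rtrancl_induct)
    case (step u w)
    show ?case
    proof (rule ccontr)
      assume "w \<notin> A"
      then have "w \<in> B" using step.hyps S by auto
      then have "u = a \<and> w = b" using cross step.hyps step.IH by auto
      then show False using no step.hyps by auto
    qed
  qed (use x in simp)
  then show False using y disj by auto
qed

lemma conn_on_join:
  assumes S: "conn_on E S" "a \<in> S" and S': "conn_on E S'" "b \<in> S'"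
  shows "conn_on E (S \<union> S')"
proof (rule conn_onI_root[OF sym])
  show "a \<in> S \<union> S'" using S by simp
  have mono: "(Restr E S)\<^sup>* \<subseteq> (Restr E (S \<union> S'))\<^sup>*" "(Restr E S')\<^sup>* \<subseteq> (Restr E (S \<union> S'))\<^sup>*"
    by (intro rtrancl_mono; auto)+
  fix x assume "x \<in> S \<union> S'"
  then show "(x, a) \<in> (Restr E (S \<union> S'))\<^sup>*"
  proof
    assume "x \<in> S"
    then show ?thesis using S mono by (auto simp: conn_on_def)
  next
    assume "x \<in> S'"
    then have "(x, b) \<in> (Restr E (S \<union> S'))\<^sup>*" using S' mono by (auto simp: conn_on_def)
    moreover have "(b, a) \<in> Restr E (S \<union> S')" using S S' symD[OF sym ab] by auto
    ultimately show ?thesis by (rule rtrancl_into_rtrancl)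
  qed
qed

lemma star_on_leaf:
  assumes "irrefl E" "B = {b}" "star_on E A a"
  shows "star_on E (A \<union> B) a"
  unfolding star_on_def
proof (intro ballI impI)
  fix x y assume xy: "x \<in> A \<union> B" "y \<in> A \<union> B" "(x, y) \<in> E"
  have yx: "(y, x) \<in> E" using sym xy(3) by (rule symD)
  consider "x \<in> A" "y \<in> A" | "x \<in> A" "y \<in> B" | "x \<in> B" "y \<in> A" | "x = b" "y = b"
    using xy assms(2) by auto
  then show "x = a \<or> y = a"
  proof cases
    case 1
    then show ?thesis using assms(3) xy by (auto simp: star_on_def)
  next
    case 2
    then show ?thesis using cross xy by blast
  next
    case 3
    then show ?thesis using cross yx by blast
  next
    case 4
    then show ?thesis using assms(1) xy by (auto simp: irrefl_def)
  qed
qed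

text \<open>A subtree through \<open>a\<close> either stays in \<open>A\<close> or uses the cut
  edge. In the second case its traces on the two sides are subtrees through \<open>a\<close> and
  \<open>b\<close>, and every such pair can be glued along the edge.\<close>

lemma rooted_subtrees_split:
  "{S. S \<in> subtrees E (A \<union> B) \<and> a \<in> S} = {S. S \<in> subtrees E A \<and> a \<in> S} \<union>
     (\<lambda>(S, S'). S \<union> S') ` ({S. S \<in> subtrees E A \<and> a \<in> S} \<times> {S. S \<in> subtrees E B \<and> b \<in> S})"
  (is "?L = ?X \<union> ?f ` (?X \<times> ?Y)")
proof (intro equalityI subsetI)
  fix S assume "S \<in> ?L"
  then have S: "S \<subseteq> A \<union> B" "conn_on E S" "a \<in> S" by (auto simp: subtrees_def)
  interpret sw: edge_split E B A b a by (rule swap)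
  show "S \<in> ?X \<union> ?f ` (?X \<times> ?Y)"
  proof (cases "S \<subseteq> A")
    case True
    then show ?thesis using S by (auto simp: subtrees_def)
  next
    case False
    then obtain y where "y \<in> S" "y \<in> B" using S by auto
    then have "b \<in> S" using conn_on_crossing S a by blast
    then have "S \<inter> A \<in> ?X" "S \<inter> B \<in> ?Y"
      using S a b conn_on_side sw.conn_on_side by (auto simp: subtrees_def Un_commute)
    moreover have "S = ?f (S \<inter> A, S \<inter> B)" using S by auto
    ultimately show ?thesis by blast
  qed
next
  fix S assume "S \<in> ?X \<union> ?f ` (?X \<times> ?Y)"
  then show "S \<in> ?L"
    using conn_on_join by (fastforce simp: subtrees_def)
qed

lemma avoiding_subtrees_split:
  "{S. S \<in> subtrees E (A \<union> B) \<and> a \<notin> S} = {S. S \<in> subtrees E A \<and> a \<notin> S} \<union> subtrees E B"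
proof (intro equalityI subsetI)
  fix S assume "S \<in> {S. S \<in> subtrees E (A \<union> B) \<and> a \<notin> S}"
  then have S: "S \<subseteq> A \<union> B" "conn_on E S" "a \<notin> S" "S \<noteq> {}" by (auto simp: subtrees_def)
  then have "S \<subseteq> A \<or> S \<subseteq> B" using conn_on_crossing[OF S(2,1)] by blast
  then show "S \<in> {S. S \<in> subtrees E A \<and> a \<notin> S} \<union> subtrees E B"
    using S by (auto simp: subtrees_def)
next
  fix S assume S: "S \<in> {S. S \<in> subtrees E A \<and> a \<notin> S} \<union> subtrees E B"
  have "a \<notin> B" using a disj by blast
  then have "a \<notin> S" using S unfolding subtrees_def by blast
  then show "S \<in> {S. S \<in> subtrees E (A \<union> B) \<and> a \<notin> S}"
    using S unfolding subtrees_def by blast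
qed

text \<open>The 1 in the second factor accounts for the subtrees contained in \<open>A\<close>;
  gluing turns unions into products because the orders add up.\<close>

lemma rooted_sum_split:
  assumes fin: "finite A" "finite B"
  shows "rooted_sum E (A \<union> B) a z = rooted_sum E A a z * (1 + rooted_sum E B b z)"
proof -
  let ?X = "{S. S \<in> subtrees E A \<and> a \<in> S}" and ?Y = "{S. S \<in> subtrees E B \<and> b \<in> S}"
  let ?f = "\<lambda>(S, S'). S \<union> S'"
  have sub: "S \<subseteq> A" if "S \<in> ?X" for S using that by (auto simp: subtrees_def)
  have sub': "S \<subseteq> B" if "S \<in> ?Y" for S using that by (auto simp: subtrees_def)
  have fX: "finite ?X" and fY: "finite ?Y" using fin by (auto simp: finite_subtrees)
  have inj: "inj_on ?f (?X \<times> ?Y)"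
  proof (rule inj_onI, clarify)
    fix S S' U U' assume SU: "S \<in> subtrees E A" "S' \<in> subtrees E B"
      "U \<in> subtrees E A" "U' \<in> subtrees E B" and eq: "S \<union> S' = U \<union> U'"
    then have "S = (S \<union> S') \<inter> A" "S' = (S \<union> S') \<inter> B" "U = (U \<union> U') \<inter> A" "U' = (U \<union> U') \<inter> B"
      using disj by (auto simp: subtrees_def)
    then show "S = U \<and> S' = U'" using eq by metis
  qed
  have card: "card (S \<union> S') = card S + card S'" if "S \<in> ?X" "S' \<in> ?Y" for S S'
    using sub[OF that(1)] sub'[OF that(2)] disj fin
    by (intro card_Un_disjoint) (auto intro: finite_subset)
  have dis: "?X \<inter> ?f ` (?X \<times> ?Y) = {}"
    using disj b by (auto simp: subtrees_def)
  have "rooted_sum E (A \<union> B) a z = (\<Sum>S\<in>?X \<union> ?f ` (?X \<times> ?Y). z ^ card S)"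
    unfolding rooted_sum_def rooted_subtrees_split ..
  also have "\<dots> = (\<Sum>S\<in>?X. z ^ card S) + (\<Sum>S\<in>?f ` (?X \<times> ?Y). z ^ card S)"
    using fX fY dis by (intro sum.union_disjoint) auto
  also have "(\<Sum>S\<in>?f ` (?X \<times> ?Y). z ^ card S) = (\<Sum>(S, S')\<in>?X \<times> ?Y. z ^ card (S \<union> S'))"
    by (subst sum.reindex[OF inj]) (simp add: case_prod_unfold)
  also have "\<dots> = (\<Sum>(S, S')\<in>?X \<times> ?Y. z ^ card S * z ^ card S')"
    by (intro sum.cong refl) (clarify, subst card, auto simp: power_add)
  also have "\<dots> = (\<Sum>S\<in>?X. z ^ card S) * (\<Sum>S\<in>?Y. z ^ card S)"
    by (simp only: sum_product sum.cartesian_product)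
  finally show ?thesis
    by (simp add: rooted_sum_def algebra_simps)
qed

lemma avoiding_sum_split:
  assumes fin: "finite A" "finite B"
  shows "avoiding_sum E (A \<union> B) a z =
    avoiding_sum E A a z + rooted_sum E B b z + avoiding_sum E B b z"
proof -
  have "avoiding_sum E (A \<union> B) a z =
      (\<Sum>S\<in>{S. S \<in> subtrees E A \<and> a \<notin> S} \<union> subtrees E B. z ^ card S)"
    unfolding avoiding_sum_def avoiding_subtrees_split ..
  also have "\<dots> = avoiding_sum E A a z + (\<Sum>S\<in>subtrees E B. z ^ card S)"
    unfolding avoiding_sum_def using disj fin
    by (intro sum.union_disjoint) (auto simp: finite_subtrees, auto simp: subtrees_def)
  finally show ?thesis using sum_subtrees[OF fin(2), of z E b] by simp
qed

end

text \<open>Take any neighbour \<open>b\<close> of \<open>r\<close> and let \<open>B\<close> be its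
  component after removal of \<open>r\<close>. The forest property makes \<open>b\<close> the only
  neighbour of \<open>r\<close> in \<open>B\<close>.\<close>

lemma edge_split_exists:
  assumes forest: "forest_rel E" and conn: "conn_on E V" and r: "r \<in> V" and ne: "V \<noteq> {r}"
  obtains A B b where "V = A \<union> B" "edge_split E A B r b" "conn_on E A" "conn_on E B"
proof -
  have sym: "sym E" using forest by (simp add: forest_rel_def)
  obtain x where x: "x \<in> V" "x \<noteq> r" using ne r by auto
  have "(r, x) \<in> (Restr E V)\<^sup>*" using conn r x by (auto simp: conn_on_def)
  then have "x \<noteq> r \<longrightarrow> (\<exists>b. (r, b) \<in> Restr E V \<and> b \<noteq> r)"
    by (induction rule: rtrancl_induct) auto
  then obtain b where b: "(r, b) \<in> E" "b \<in> V" "b \<noteq> r" using x by auto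
  define B where "B = {w. (b, w) \<in> (Restr E (V - {r}))\<^sup>*}"
  define A where "A = V - B"
  have bB: "b \<in> B" by (simp add: B_def)
  have BV: "B \<subseteq> V - {r}"
  proof
    fix w assume "w \<in> B"
    then have "(b, w) \<in> (Restr E (V - {r}))\<^sup>*" by (simp add: B_def)
    then show "w \<in> V - {r}" by (induction rule: rtrancl_induct) (use b in auto)
  qed
  have V: "V = A \<union> B" using BV by (auto simp: A_def)
  have split: "edge_split E A B r b"
  proof
    fix u w assume u: "u \<in> A" and w: "w \<in> B" and uw: "(u, w) \<in> E"
    have wu: "(w, u) \<in> E" using sym uw by (rule symD)
    have ur: "u = r"
    proof (rule ccontr)
      assume "u \<noteq> r"
      then have "(w, u) \<in> Restr E (V - {r})" using wu u w BV by (auto simp: A_def)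
      then have "u \<in> B" using w unfolding B_def by (auto intro: rtrancl_into_rtrancl)
      then show False using u by (simp add: A_def)
    qed
    have "(Restr E (V - {r}))\<^sup>* \<subseteq> (Restr E (- {r}))\<^sup>*" by (intro rtrancl_mono) auto
    then have bw: "(b, w) \<in> (Restr E (- {r}))\<^sup>*" using w by (auto simp: B_def)
    have "w = b"
    proof (rule ccontr)
      assume "w \<noteq> b"
      then show False using forest bw b uw ur w BV unfolding forest_rel_def by blast
    qed
    then show "u = r \<and> w = b" using ur by simp
  qed (use sym r b bB BV in \<open>auto simp: A_def\<close>)
  then interpret edge_split E A B r b .
  interpret sw: edge_split E B A b r by (rule swap)
  have "conn_on E (V \<inter> A)" "conn_on E (V \<inter> B)"
    using conn_on_side[OF conn] sw.conn_on_side[OF conn] V r b by auto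
  moreover have "V \<inter> A = A" "V \<inter> B = B" using V by auto
  ultimately show thesis using that V split by simp
qed

lemma conn_on_edgeless:
  assumes "conn_on E V" "b \<in> V" and no: "\<And>x y. x \<in> V \<Longrightarrow> y \<in> V \<Longrightarrow> (x, y) \<notin> E"
  shows "V = {b}"
proof -
  have "x = b" if "x \<in> V" for x
  proof -
    have "(b, x) \<in> (Restr E V)\<^sup>*" using assms that by (auto simp: conn_on_def)
    moreover have "Restr E V = {}" using no by auto
    ultimately show ?thesis by simp
  qed
  then show ?thesis using assms(2) by blast
qed

section \<open>Stars rooted at their centre\<close>

text \<open>Subtrees through the centre choose an arbitrary set of leaves, all others are single
  leaves. The induction peels off one leaf: a branch misses the centre, hence has no edges and is a
  single vertex.\<close>

lemma star_sums:
  assumes "forest_rel E" "finite V" "conn_on E V" "r \<in> V" "star_on E V r"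
  shows "rooted_sum E V r z = z * (1 + z) ^ (card V - 1) \<and>
    avoiding_sum E V r z = of_nat (card V - 1) * z"
  using assms(2-)
proof (induction "card V" arbitrary: V rule: less_induct)
  case less
  show ?case
  proof (cases "V = {r}")
    case True
    then show ?thesis by (simp add: rooted_sum_singleton avoiding_sum_singleton)
  next
    case False
    then obtain A B b where V: "V = A \<union> B" and split: "edge_split E A B r b"
      and cA: "conn_on E A" and cB: "conn_on E B"
      using edge_split_exists[OF assms(1) less.prems(2,3)] by metis
    interpret edge_split E A B r b by (rule split)
    have fin: "finite A" "finite B" using V less.prems by auto
    have "r \<notin> B" using disj a by auto
    then have B: "B = {b}"
      using less.prems V cB b by (intro conn_on_edgeless[of E]) (auto simp: star_on_def)
    have card: "card V = Suc (card A)" using V B disj fin by auto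
    have "card A > 0" using fin a card_gt_0_iff by auto
    then obtain m where m: "card A = Suc m" by (cases "card A") auto
    have "star_on E A r" using less.prems V by (auto simp: star_on_def)
    then have IH: "rooted_sum E A r z = z * (1 + z) ^ m" "avoiding_sum E A r z = of_nat m * z"
      using less.hyps[of A] card fin cA a m by auto
    show ?thesis
      using rooted_sum_split[OF fin, of z] avoiding_sum_split[OF fin, of z] IH card m
      unfolding V B by (simp add: rooted_sum_singleton avoiding_sum_singleton algebra_simps)
  qed
qed

section \<open>The dominance estimate\<close>

text \<open>The bound 36/25 is sharp enough for the weight threshold 5/2 used below, since (1 +
  36/25) * 36/25 > 5/2 + 1.\<close>

lemma root3_bounds: "36 / 25 < root 3 3" "root 3 3 ^ 3 = 3"
proof -
  show cube: "root 3 3 ^ 3 = 3" by simp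
  show "36 / 25 < root 3 3"
  proof (rule ccontr)
    assume "\<not> 36 / 25 < root 3 3"
    then have "root 3 3 ^ 3 \<le> (36 / 25 :: real) ^ 3" by (intro power_mono) auto
    then show False unfolding cube by (simp add: power3_eq_cube)
  qed
qed

text \<open>From \<open>m = 4\<close> on, the left side grows by a factor of at most 5/4 per step
  and the right side by more than 36/25; smaller \<open>m\<close> are compared directly. Equality is
  possible only at \<open>m = 3\<close>, and this fixes the radius of the disk.\<close>

lemma less_power_of_ge_root3:
  assumes q: "root 3 3 \<le> q"
  shows "m \<noteq> 3 \<Longrightarrow> real m < q ^ m" and "real m \<le> q ^ m"
    and "q \<noteq> root 3 3 \<Longrightarrow> real m < q ^ m"
proof -
  have q1: "36 / 25 < q" using q root3_bounds by linarith
  have q2: "207 / 100 < q ^ 2" using power_strict_mono[OF q1, of 2] by (simp add: power2_eq_square)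
  have q4: "21 / 5 < q ^ 4" using power_strict_mono[OF q1, of 4] by (simp add: power4_eq_xxxx)
  have large: "real m < q ^ m" if "m \<ge> 4" for m
    using that
  proof (induction m rule: nat_induct_at_least)
    case base
    then show ?case using q4 by simp
  next
    case (Suc n)
    have "real (Suc n) \<le> 36 / 25 * real n" using Suc.hyps by simp
    also have "\<dots> \<le> q * q ^ n" using Suc.IH q1 by (intro mult_mono) auto
    finally have "real (Suc n) \<le> q * q ^ n" .
    moreover have "36 / 25 * real n < q * q ^ n"
      using Suc.IH q1 Suc.hyps by (intro mult_strict_mono) auto
    ultimately show ?case using Suc.hyps by simp
  qed
  show strict: "real m < q ^ m" if "m \<noteq> 3"
  proof -
    have "m = 0 \<or> m = 1 \<or> m = 2 \<or> m \<ge> 4" using that by linarith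
    then show ?thesis using q1 q2 large by auto
  qed
  have q3: "3 \<le> q ^ 3" using power_mono[OF q, of 3] root3_bounds by simp
  show "real m \<le> q ^ m" using strict q3 by (cases "m = 3") auto
  show "real m < q ^ m" if "q \<noteq> root 3 3"
  proof -
    have "root 3 3 < q" using q that by simp
    then have "3 < q ^ 3" using power_strict_mono[of "root 3 3" q 3] root3_bounds by simp
    then show ?thesis using strict by (cases "m = 3") auto
  qed
qed

text \<open>Expand \<open>(x - 1) * (y - 1) > 1\<close>.\<close>

lemma add_less_mult_of_ge_2:
  fixes x y :: real
  assumes "2 \<le> x" "2 < y"
  shows "x + y < x * y"
proof -
  have "1 * 1 < (x - 1) * (y - 1)" using assms by (intro mult_le_less_imp_less) auto
  then show ?thesis by (simp add: algebra_simps)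
qed

section \<open>Rooted trees at a point of large modulus\<close>

locale large_modulus =
  fixes E :: "('a \<times> 'a) set" and z :: complex
  assumes forest: "forest_rel E" and large: "1 + root 3 3 \<le> cmod z"
begin

abbreviation R :: real where "R \<equiv> cmod z"
abbreviation q :: real where "q \<equiv> cmod z - 1"

lemma q_ge: "root 3 3 \<le> q" and q_gt: "36 / 25 < q"
  using large root3_bounds by auto

lemma cmod_one_plus: "cmod w - 1 \<le> cmod (1 + w)"
  using norm_triangle_ineq2[of w "- 1"] by (simp add: add.commute)

text \<open>The exceptional tree K_{1,3} on the boundary circle. No root is mentioned, so the centre
  and a leaf are both covered as roots.\<close>

definition extremal :: "'a set \<Rightarrow> bool" where
  "extremal V \<longleftrightarrow> R = 1 + root 3 3 \<and> card V = 4 \<and> (\<exists>c\<in>V. star_on E V c)"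

text \<open>The first clause makes the property usable in the induction: divided by
  \<open>R\<close>, the rooted sum acts like a branch weight of at least 5/2. A single vertex fails
  it, which is why stars rooted at the centre are kept as a separate case.\<close>

definition dominated :: "'a set \<Rightarrow> 'a \<Rightarrow> bool" where
  "dominated V r \<longleftrightarrow> 5 / 2 * R \<le> cmod (rooted_sum E V r z) \<and>
     cmod (avoiding_sum E V r z) \<le> cmod (rooted_sum E V r z) \<and>
     (cmod (avoiding_sum E V r z) < cmod (rooted_sum E V r z) \<or> extremal V)"

text \<open>\<open>cmod (rooted_sum E V r z) - 1\<close> is the factor the branch guarantees for the
  rooted sum of the larger tree, and the left side of the inequality bounds what it adds to the
  avoiding sum. The tight case is the path on three vertices rooted at its middle, which becomes
  K_{1,3} when hung below a new leaf.\<close>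

definition heavy_branch :: "'a set \<Rightarrow> 'a \<Rightarrow> bool" where
  "heavy_branch V r \<longleftrightarrow> 5 / 2 \<le> cmod (rooted_sum E V r z) - 1 \<and>
     cmod (rooted_sum E V r z) + cmod (avoiding_sum E V r z)
       \<le> R * (cmod (rooted_sum E V r z) - 1) \<and>
     (cmod (rooted_sum E V r z) + cmod (avoiding_sum E V r z)
       < R * (cmod (rooted_sum E V r z) - 1) \<or>
      R = 1 + root 3 3 \<and> card V = 3 \<and> star_on E V r)"

lemma star_bounds:
  assumes "finite V" "conn_on E V" "r \<in> V" "star_on E V r" "card V = Suc m"
  shows "R * q ^ m \<le> cmod (rooted_sum E V r z)" "cmod (avoiding_sum E V r z) = R * real m"
proof -
  have sums: "rooted_sum E V r z = z * (1 + z) ^ m" "avoiding_sum E V r z = of_nat m * z"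
    using star_sums[OF forest assms(1-4), of z] assms(5) by auto
  have "q ^ m \<le> cmod (1 + z) ^ m" using q_gt cmod_one_plus by (intro power_mono) auto
  then show "R * q ^ m \<le> cmod (rooted_sum E V r z)"
    unfolding sums by (simp add: norm_mult norm_power mult_left_mono)
  show "cmod (avoiding_sum E V r z) = R * real m"
    unfolding sums by (simp add: norm_mult)
qed

text \<open>With \<open>m\<close> leaves the claim reduces to \<open>Suc m \<le> q ^ Suc m\<close>.
  Because of this shift the tight branch has two leaves rather than three.\<close>

lemma star_imp_heavy_branch:
  assumes V: "finite V" "conn_on E V" "r \<in> V" "star_on E V r" and "V \<noteq> {r}"
  shows "heavy_branch V r"
proof -
  have "card V \<noteq> 0" "card V \<noteq> 1" using V \<open>V \<noteq> {r}\<close> by (auto simp: card_1_singleton_iff)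
  then obtain m where m: "card V = Suc m" "m \<ge> 1" by (cases "card V") auto
  let ?f = "cmod (rooted_sum E V r z)" and ?g = "cmod (avoiding_sum E V r z)"
  note b = star_bounds[OF V m(1)]
  have R0: "0 < R" using q_gt by linarith
  have "q ^ 1 \<le> q ^ m" using m q_gt by (intro power_increasing) auto
  \<comment> \<open>Here 61/25 = 1 + 36/25 is a lower bound for \<open>R\<close>, and the product
    exceeds 7/2.\<close>
  then have "61 / 25 * (36 / 25) \<le> R * q ^ m" using q_gt by (intro mult_mono) auto
  then have "5 / 2 \<le> ?f - 1" using b by simp
  moreover have fq: "R * q ^ Suc m \<le> q * ?f"
    using mult_left_mono[OF b(1), of q] q_gt by (simp add: algebra_simps)
  have key: "?f + ?g \<le> R * (?f - 1) \<longleftrightarrow> R * real (Suc m) \<le> q * ?f"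
    "?f + ?g < R * (?f - 1) \<longleftrightarrow> R * real (Suc m) < q * ?f"
    unfolding b(2) by (auto simp: algebra_simps)
  have "R * real (Suc m) \<le> R * q ^ Suc m"
    using less_power_of_ge_root3(2)[OF q_ge, of "Suc m"] R0 by (intro mult_left_mono) auto
  then have "?f + ?g \<le> R * (?f - 1)" using key fq by linarith
  moreover have "?f + ?g < R * (?f - 1)" if "Suc m \<noteq> 3 \<or> q \<noteq> root 3 3"
  proof -
    have "real (Suc m) < q ^ Suc m" using less_power_of_ge_root3(1,3)[OF q_ge, of "Suc m"] that by auto
    then have "R * real (Suc m) < R * q ^ Suc m" using R0 by (rule mult_strict_left_mono)
    then show ?thesis using key fq by linarith
  qed
  moreover have "R = 1 + root 3 3 \<and> card V = 3" if "\<not> (Suc m \<noteq> 3 \<or> q \<noteq> root 3 3)"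
    using that m by auto
  ultimately show ?thesis unfolding heavy_branch_def using V by blast
qed

text \<open>As the avoiding sum is at most the rooted sum \<open>?f\<close>, it suffices that
  \<open>R < (R - 2) * ?f\<close>, and 11/25 * 5/2 = 11/10 > 1. The inequality is strict even for an
  extremal tree, so such a tree is never tight as a branch of a larger one.\<close>

lemma dominated_imp_heavy_branch:
  assumes "dominated V r"
  shows "heavy_branch V r"
proof -
  let ?f = "cmod (rooted_sum E V r z)" and ?g = "cmod (avoiding_sum E V r z)"
  have f: "5 / 2 * R \<le> ?f" and g: "?g \<le> ?f" using assms by (auto simp: dominated_def)
  have "R * (11 / 10) \<le> (R - 2) * ?f"
  proof -
    have "11 / 25 * (5 / 2 * R) \<le> (R - 2) * ?f" using f q_gt by (intro mult_mono) auto
    then show ?thesis by simp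
  qed
  moreover have "0 < R" using q_gt by linarith
  ultimately have "R < (R - 2) * ?f" by linarith
  then have "?f + ?g < R * (?f - 1)" using g by (simp add: algebra_simps)
  moreover have "5 / 2 \<le> ?f - 1" using f q_gt by simp
  ultimately show ?thesis unfolding heavy_branch_def by simp
qed

text \<open>Induction on the order, splitting off a single branch \<open>B\<close> at
  \<open>r\<close>. Both parts are smaller: \<open>A\<close> with root \<open>r\<close> and
  \<open>B\<close> with root \<open>b\<close> are each a star or dominated, so the branches at
  \<open>r\<close> need not be treated all at once.\<close>

lemma star_or_dominated:
  assumes "finite V" "conn_on E V" "r \<in> V"
  shows "star_on E V r \<or> dominated V r"
  using assms
proof (induction "card V" arbitrary: V r rule: less_induct)
  case less
  show ?case
  proof (cases "V = {r}")
    case True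
    then show ?thesis by (simp add: star_on_def)
  next
    case False
    then obtain A B b where V: "V = A \<union> B" and split: "edge_split E A B r b"
      and cA: "conn_on E A" and cB: "conn_on E B"
      using edge_split_exists[OF forest less.prems(2,3)] by metis
    interpret edge_split E A B r b by (rule split)
    interpret sw: edge_split E B A b r by (rule swap)
    have irrefl: "irrefl E" using forest by (simp add: forest_rel_def)
    have fin: "finite A" "finite B" using V less.prems by auto
    have card: "card V = card A + card B" using V disj fin card_Un_disjoint by auto
    have "card A > 0" "card B > 0" using fin a b card_gt_0_iff by auto
    then have lt: "card A < card V" "card B < card V" using card by auto
    define f g where "f = cmod (rooted_sum E V r z)" and "g = cmod (avoiding_sum E V r z)"
    define fA gA where "fA = cmod (rooted_sum E A r z)" and "gA = cmod (avoiding_sum E A r z)"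
    define fB gB where "fB = cmod (rooted_sum E B b z)" and "gB = cmod (avoiding_sum E B b z)"
    have f_ge: "fA * (fB - 1) \<le> f"
      unfolding f_def fA_def fB_def V rooted_sum_split[OF fin] norm_mult
      by (intro mult_left_mono cmod_one_plus) auto
    have g_le: "g \<le> gA + (fB + gB)"
      unfolding g_def gA_def fB_def gB_def V avoiding_sum_split[OF fin]
      by (metis norm_triangle_ineq norm_triangle_le add.assoc add_left_mono)
    have R0: "0 < R" using q_gt by linarith
    have dominatedI: "dominated V r"
      if "5 / 2 * R \<le> f" "g \<le> f" "g < f \<or> extremal V"
      using that by (simp add: dominated_def f_def g_def)
    have IHA: "star_on E A r \<or> dominated A r" using less.hyps lt fin cA a by blast
    have domA: "5 / 2 * R \<le> fA" "gA \<le> fA" if "dominated A r"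
      using that by (auto simp: dominated_def fA_def gA_def)
    show ?thesis
    proof (cases "B = {b}")
      case True
      have B: "fB = R" "gB = 0"
        by (simp_all add: fB_def gB_def True rooted_sum_singleton avoiding_sum_singleton)
      show ?thesis
      proof (cases "star_on E A r")
        case starA: True
        have "star_on E V r" using star_on_leaf[OF irrefl True starA] V by simp
        then show ?thesis ..
      next
        case False
        then have dA: "5 / 2 * R \<le> fA" "gA \<le> fA" using IHA domA by auto
        \<comment> \<open>A new leaf multiplies the lower bound \<open>fA\<close> by
          \<open>q\<close>; the gain \<open>(q - 1) * fA\<close> has to exceed the \<open>R\<close>
          that the leaf adds to the avoiding sum.\<close>
        have "11 / 25 * (5 / 2 * R) \<le> (q - 1) * fA" using dA q_gt by (intro mult_mono) auto
        then have "R < (q - 1) * fA" using R0 by linarith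
        then have gf: "gA + R < fA * (fB - 1)" using dA B by (simp add: algebra_simps)
        have "5 / 2 * R \<le> fA + R" using dA R0 by linarith
        then have "5 / 2 * R \<le> f" using \<open>R < (q - 1) * fA\<close> f_ge B by (simp add: algebra_simps)
        then show ?thesis using dominatedI gf f_ge g_le B by auto
      qed
    next
      case False
      have "star_on E B b \<or> dominated B b" using less.hyps lt fin cB b by blast
      then have "heavy_branch B b"
        using star_imp_heavy_branch[OF fin(2) cB b _ False] dominated_imp_heavy_branch by auto
      then have B: "5 / 2 \<le> fB - 1" "fB + gB \<le> R * (fB - 1)"
        "fB + gB < R * (fB - 1) \<or> R = 1 + root 3 3 \<and> card B = 3 \<and> star_on E B b"
        by (auto simp: heavy_branch_def fB_def gB_def)
      have "dominated V r"
      proof (cases "star_on E A r")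
        case False
        then have dA: "5 / 2 * R \<le> fA" "gA \<le> fA" using IHA domA by auto
        \<comment> \<open>After division by \<open>R\<close>, the comparison of \<open>g\<close>
          with \<open>f\<close> becomes that of the sum with the product of the weights
          \<open>p\<close> and \<open>fB - 1\<close>, both at least 5/2.\<close>
        obtain p where p: "fA = R * p"
          using R0 by (metis less_irrefl nonzero_mult_div_cancel_left times_divide_eq_right)
        have "5 / 2 \<le> p" using dA(1) R0 unfolding p by simp
        then have "p + (fB - 1) < p * (fB - 1)"
          using B by (intro add_less_mult_of_ge_2) linarith+
        then have "R * (p + (fB - 1)) < R * (p * (fB - 1))"
          using R0 by (rule mult_strict_left_mono)
        then have "fA + R * (fB - 1) < fA * (fB - 1)"
          unfolding p by (simp add: distrib_left mult.assoc)
        moreover have "0 \<le> R * (fB - 1)" using B R0 by simp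
        ultimately have "5 / 2 * R \<le> f" "g < f" using f_ge g_le dA B by linarith+
        then show ?thesis using dominatedI by simp
      next
        case starA: True
        \<comment> \<open>Now \<open>r\<close> has \<open>m\<close> leaf children besides the branch
          \<open>B\<close>, and the comparison to prove is \<open>m + (fB - 1)\<close> against
          \<open>q ^ m * (fB - 1)\<close>.\<close>
        obtain m where m: "card A = Suc m" using \<open>card A > 0\<close> by (cases "card A") auto
        have A: "R * q ^ m \<le> fA" "gA = R * real m"
          using star_bounds[OF fin(1) cA a starA m] by (auto simp: fA_def gA_def)
        have f_ge': "R * (q ^ m * (fB - 1)) \<le> f"
        proof -
          have "R * q ^ m * (fB - 1) \<le> fA * (fB - 1)"
            using A(1) B(1) by (intro mult_right_mono) auto
          then show ?thesis using f_ge by (simp add: mult.assoc)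
        qed
        have g_le': "g \<le> R * (real m + (fB - 1))"
          using g_le A(2) B(2) unfolding distrib_left by linarith
        have "1 * (fB - 1) \<le> q ^ m * (fB - 1)"
          using B q_gt by (intro mult_right_mono one_le_power) auto
        then have "5 / 2 \<le> q ^ m * (fB - 1)"
          unfolding mult_1 using B(1) by (rule order_trans[rotated])
        then have "R * (5 / 2) \<le> R * (q ^ m * (fB - 1))" using R0 by (intro mult_left_mono) auto
        then have f52: "5 / 2 * R \<le> f" using f_ge' by simp
        show ?thesis
        proof (cases "m = 0")
          case True
          then have "A = {r}" using m a by (auto simp: card_1_singleton_iff)
          have gf: "g \<le> fB + gB" "R * (fB - 1) \<le> f" using g_le f_ge' A True by auto
          \<comment> \<open>With \<open>m = 0\<close> the root is itself a leaf, and hanging it onto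
            a tight \<open>B\<close> produces K_{1,3} with centre \<open>b\<close>.\<close>
          moreover have "extremal V" if "R = 1 + root 3 3" "card B = 3" "star_on E B b"
          proof -
            have "star_on E (B \<union> A) b" using sw.star_on_leaf[OF irrefl \<open>A = {r}\<close> that(3)] .
            then have "star_on E V b" using V by (simp add: Un_commute)
            then show ?thesis using that card m True V b by (auto simp: extremal_def)
          qed
          ultimately have "g < f \<or> extremal V"
            using B(3) by (meson le_less_trans less_le_trans)
          moreover have "g \<le> f" using gf B(2) by linarith
          ultimately show ?thesis using dominatedI f52 by blast
        next
          case False
          have "real m + (fB - 1) < q ^ m * (fB - 1)"
          proof (cases "m = 1")
            case True
            \<comment> \<open>For \<open>m = 1\<close> the power \<open>q\<close> may be below 2, so
              the sum-product inequality does not apply; instead the gain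
              \<open>(q - 1) * (fB - 1)\<close> is at least 11/10 and beats the single leaf.\<close>
            have "11 / 25 * (5 / 2) \<le> (q - 1) * (fB - 1)" using B q_gt by (intro mult_mono) auto
            then show ?thesis using True by (simp add: algebra_simps)
          next
            case m1: False
            have "real m \<le> q ^ m" by (rule less_power_of_ge_root3(2)[OF q_ge])
            moreover have "2 \<le> q ^ m" using calculation m1 False by linarith
            moreover have "q ^ m + (fB - 1) < q ^ m * (fB - 1)"
              using calculation B by (intro add_less_mult_of_ge_2) auto
            ultimately show ?thesis by linarith
          qed
          then have "R * (real m + (fB - 1)) < R * (q ^ m * (fB - 1))"
            using R0 by (rule mult_strict_left_mono)
          then have "g < f" using f_ge' g_le' by linarith
          then show ?thesis using dominatedI f52 by simp
        qed
      qed
      then show ?thesis ..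
    qed
  qed
qed

text \<open>The sum splits into two parts of different modulus, whichever root is chosen. If that
  root is the centre of a star, \<open>real m < q ^ m\<close> gives this directly.\<close>

lemma subtree_sum_ne_0:
  assumes V: "finite V" "conn_on E V" "V \<noteq> {}" and "\<not> extremal V"
  shows "(\<Sum>S\<in>subtrees E V. z ^ card S) \<noteq> 0"
proof -
  obtain r where r: "r \<in> V" using V by auto
  let ?f = "rooted_sum E V r z" and ?g = "avoiding_sum E V r z"
  have "cmod ?g < cmod ?f"
  proof (cases "star_on E V r")
    case False
    then show ?thesis
      using star_or_dominated[OF V(1,2) r] assms(4) by (auto simp: dominated_def)
  next
    case True
    have "card V \<noteq> 0" using V by auto
    then obtain m where m: "card V = Suc m" by (cases "card V") auto
    note b = star_bounds[OF V(1,2) r True m]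
    have "m \<noteq> 3 \<or> q \<noteq> root 3 3" using assms(4) r True m by (auto simp: extremal_def)
    then have "real m < q ^ m" using less_power_of_ge_root3(1,3)[OF q_ge] by auto
    moreover have "0 < R" using q_gt by linarith
    ultimately have "R * real m < R * q ^ m" by simp
    then show ?thesis using b by linarith
  qed
  then have "?f + ?g \<noteq> 0" by (metis add_eq_0_iff norm_minus_cancel less_irrefl)
  then show ?thesis using sum_subtrees[OF V(1), of z E r] by simp
qed

end

section \<open>Trees as symmetric digraphs\<close>

lemma arcs_ends_induce_subgraph: "arcs_ends (G \<restriction> X) = Restr (arcs_ends G) X"
  by (auto simp: arcs_ends_conv)

text \<open>Connectedness is strong connectedness of the symmetric closure; for symmetric arcs the
  closure does not change reachability.\<close>

lemma connected_induce_subgraph_iff: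
  assumes "sym_digraph G" and X: "X \<subseteq> verts G"
  shows "Digraph_Component.connected (G \<restriction> X) \<longleftrightarrow> X \<noteq> {} \<and> conn_on (arcs_ends G) X"
proof -
  interpret sym_digraph G by fact
  interpret H: wf_digraph "G \<restriction> X" by (rule wellformed_induce_subgraph)
  have sym: "symmetric (G \<restriction> X)"
    using induced_graph_imp_symmetric[OF sym_arcs induced_induce[OF X]] .
  have "u \<rightarrow>\<^sup>*\<^bsub>mk_symmetric (G \<restriction> X)\<^esub> v \<longleftrightarrow> (u, v) \<in> (Restr (arcs_ends G) X)\<^sup>*" if "u \<in> X" for u v
    using H.reachable_mk_symmetric_eq[OF sym] H.reachable_conv'[of u v] that
    by (simp add: arcs_ends_induce_subgraph)
  then show ?thesis
    unfolding Digraph_Component.connected_def strongly_connected_def conn_on_def by auto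
qed

lemma connected_iff:
  assumes "sym_digraph G"
  shows "Digraph_Component.connected G \<longleftrightarrow> verts G \<noteq> {} \<and> conn_on (arcs_ends G) (verts G)"
proof -
  interpret sym_digraph G by fact
  have "G \<restriction> verts G = G" by (rule pre_digraph.equality) auto
  then show ?thesis using connected_induce_subgraph_iff[OF assms, of "verts G"] by simp
qed

text \<open>Compatibility equates the whole tail and head maps, not only their values on arcs. The
  vertex set therefore determines the record, and \<open>subtree_count\<close> counts no subtree
  twice.\<close>

lemma induced_subgraph_eq_induce_subgraph:
  assumes "induced_subgraph S G"
  shows "G \<restriction> verts S = S"
  using assms
  by (intro pre_digraph.equality) (auto simp: induced_subgraph_def subgraph_def compatible_def)

lemma connected_induced_subgraph_iff:
  assumes G: "sym_digraph G"
  shows "induced_subgraph S G \<and> Digraph_Component.connected S \<longleftrightarrow>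
     S = G \<restriction> verts S \<and> verts S \<in> subtrees (arcs_ends G) (verts G)"
proof
  assume S: "induced_subgraph S G \<and> Digraph_Component.connected S"
  then have eq: "G \<restriction> verts S = S" using induced_subgraph_eq_induce_subgraph by blast
  have sub: "verts S \<subseteq> verts G"
    using S induced_imp_subgraph subgraph_imp_subverts by blast
  show "S = G \<restriction> verts S \<and> verts S \<in> subtrees (arcs_ends G) (verts G)"
    using connected_induce_subgraph_iff[OF G sub] S sub unfolding eq subtrees_def by simp
next
  assume S: "S = G \<restriction> verts S \<and> verts S \<in> subtrees (arcs_ends G) (verts G)"
  then have sub: "verts S \<subseteq> verts G" and eq: "G \<restriction> verts S = S" by (simp_all add: subtrees_def)
  show "induced_subgraph S G \<and> Digraph_Component.connected S"
    using connected_induce_subgraph_iff[OF G sub] wf_digraph.induced_induce[OF sym_digraph.axioms(1)[OF G] sub] S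
    unfolding eq subtrees_def by simp
qed

lemma subtree_count_eq:
  assumes G: "sym_digraph G"
  shows "subtree_count G k = card {X \<in> subtrees (arcs_ends G) (verts G). card X = k}"
proof -
  let ?X = "{X \<in> subtrees (arcs_ends G) (verts G). card X = k}"
  have "{S. induced_subgraph S G \<and> Digraph_Component.connected S \<and> card (verts S) = k} =
      (\<lambda>X. G \<restriction> X) ` ?X" (is "?D = _")
  proof (intro equalityI subsetI)
    fix S assume "S \<in> ?D"
    then have "S = G \<restriction> verts S" "verts S \<in> ?X"
      using connected_induced_subgraph_iff[OF G, of S] by blast+
    then show "S \<in> (\<lambda>X. G \<restriction> X) ` ?X" by (rule image_eqI)
  next
    fix S assume "S \<in> (\<lambda>X. G \<restriction> X) ` ?X"
    then obtain X where X: "S = G \<restriction> X" "X \<in> ?X" by blast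
    then show "S \<in> ?D" using connected_induced_subgraph_iff[OF G, of S] by simp
  qed
  moreover have "inj_on (\<lambda>X. G \<restriction> X) ?X"
    by (rule inj_on_inverseI[where g = verts]) simp
  ultimately show ?thesis unfolding subtree_count_def by (simp add: card_image)
qed

lemma poly_subtree_poly:
  assumes "graph G"
  shows "poly (subtree_poly G) z = (\<Sum>X\<in>subtrees (arcs_ends G) (verts G). z ^ card X)"
proof -
  interpret graph G by fact
  let ?C = "subtrees (arcs_ends G) (verts G)"
  have fin: "finite ?C" by (simp add: finite_subtrees)
  have card: "card ` ?C \<subseteq> {1..card (verts G)}"
  proof clarify
    fix X assume "X \<in> ?C"
    then have "X \<subseteq> verts G" "X \<noteq> {}" by (auto simp: subtrees_def)
    then show "card X \<in> {1..card (verts G)}"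
      using card_mono[of "verts G" X] finite_subset[of X "verts G"]
      by (simp add: Suc_le_eq card_gt_0_iff)
  qed
  have "poly (subtree_poly G) z =
      (\<Sum>k = 1..card (verts G). of_nat (card {X \<in> ?C. card X = k}) * z ^ k)"
    by (simp add: subtree_poly_def poly_sum poly_monom subtree_count_eq[OF sym_digraph_axioms])
  also have "\<dots> = (\<Sum>k = 1..card (verts G). \<Sum>X\<in>{X \<in> ?C. card X = k}. z ^ card X)"
    by (intro sum.cong refl) simp
  also have "\<dots> = (\<Sum>X\<in>?C. z ^ card X)"
    using fin card by (intro sum.group) auto
  finally show ?thesis .
qed

section \<open>Acyclicity of undirected trees\<close>

text \<open>A path from \<open>v\<close> to \<open>w\<close> avoiding \<open>r\<close> would be
  closed up by the arcs \<open>rv\<close> and \<open>wr\<close> to a cycle. The path is nonempty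
  because \<open>v \<noteq> w\<close>, so the cycle has at least the forbidden length 3.\<close>

lemma forest_rel_undirected_tree:
  assumes "undirected_tree T"
  shows "forest_rel (arcs_ends T)"
proof -
  interpret graph T using assms by (simp add: undirected_tree_def)
  have nocyc: "\<nexists>p. cycle p \<and> length p \<ge> 3" using assms by (simp add: undirected_tree_def)
  have "(v, w) \<notin> (Restr (arcs_ends T) (- {r}))\<^sup>*"
    if rv: "(r, v) \<in> arcs_ends T" and rw: "(r, w) \<in> arcs_ends T" and "v \<noteq> w" for r v w
  proof
    assume vw: "(v, w) \<in> (Restr (arcs_ends T) (- {r}))\<^sup>*"
    let ?H = "T \<restriction> (verts T - {r})"
    interpret H: wf_digraph ?H by (rule wellformed_induce_subgraph)
    have "Restr (arcs_ends T) (- {r}) = arcs_ends ?H"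
      using adj_in_verts by (auto simp: arcs_ends_induce_subgraph)
    moreover have "v \<noteq> r" using rv adj_not_same by auto
    moreover have vT: "v \<in> verts T" using rv adj_in_verts by auto
    ultimately have "v \<rightarrow>\<^sup>*\<^bsub>?H\<^esub> w" using vw by (subst H.reachable_conv') auto
    then obtain p where p: "H.apath v p w" using H.reachable_apath by auto
    have sub: "subgraph ?H T" by (intro induced_imp_subgraph induced_induce) auto
    have path: "apath v p w" using subgraph_apath_imp_apath[OF p sub] .
    have "set (H.awalk_verts v p) \<subseteq> verts ?H"
      using p H.awalk_verts_in_verts unfolding H.apath_def by blast
    moreover have "H.awalk_verts = awalk_verts"
      by (rule compatible_awalk_verts[OF compatible_induce_subgraph])
    ultimately have r: "r \<notin> set (awalk_verts v p)" by auto
    have "p \<noteq> []" using path \<open>v \<noteq> w\<close> by (auto simp: apath_Nil_iff)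
    obtain e1 where e1: "e1 \<in> arcs T" "tail T e1 = r" "head T e1 = v" using rv by auto
    have "(w, r) \<in> arcs_ends T" using graph_symmetric[OF rw] .
    then obtain e2 where e2: "e2 \<in> arcs T" "tail T e2 = w" "head T e2 = r" by auto
    let ?c = "e1 # p @ [e2]"
    have walk: "awalk v p w" using path by (simp add: apath_def)
    have walk2: "awalk v (p @ [e2]) r"
      using walk e2 by (auto simp: awalk_simps)
    then have "awalk r ?c r" using e1 by (auto simp: awalk_Cons_iff)
    moreover have "awalk_verts v (p @ [e2]) = awalk_verts v p @ [r]"
      using awalk_verts_append[OF walk2] e2 walk by (auto simp: awalk_verts_conv)
    then have "distinct (tl (awalk_verts r ?c))"
      using e1 r path by (simp add: apath_def)
    ultimately have "cycle ?c" unfolding cycle_def by blast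
    moreover have "length ?c \<ge> 3" using \<open>p \<noteq> []\<close> by (cases p) auto
    ultimately show False using nocyc by blast
  qed
  moreover have "sym (arcs_ends T)" using sym_arcs by (simp add: symmetric_def)
  moreover have "irrefl (arcs_ends T)" using adj_not_same by (auto simp: irrefl_def)
  ultimately show ?thesis by (simp add: forest_rel_def)
qed

section \<open>The star K_{1,3} as a digraph\<close>

lemma complete_bipartite_1_3_iff:
  "complete_bipartite_digraph 1 3 T \<longleftrightarrow> graph T \<and> card (verts T) = 4 \<and>
     (\<exists>c\<in>verts T. arcs_ends T = {c} \<times> (verts T - {c}) \<union> (verts T - {c}) \<times> {c})"
proof
  assume "complete_bipartite_digraph 1 3 T"
  then obtain U W where T: "graph T" "verts T = U \<union> W" "U \<inter> W = {}" "card U = 1" "card W = 3"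
    "arcs_ends T = U \<times> W \<union> W \<times> U"
    by (auto simp: complete_bipartite_digraph_def)
  then obtain c where c: "U = {c}" by (auto simp: card_1_singleton_iff)
  then have "verts T - {c} = W" using T by auto
  moreover have "finite W" using T(5) card.infinite by fastforce
  ultimately show "graph T \<and> card (verts T) = 4 \<and>
     (\<exists>c\<in>verts T. arcs_ends T = {c} \<times> (verts T - {c}) \<union> (verts T - {c}) \<times> {c})"
    using T c by auto
next
  assume "graph T \<and> card (verts T) = 4 \<and>
     (\<exists>c\<in>verts T. arcs_ends T = {c} \<times> (verts T - {c}) \<union> (verts T - {c}) \<times> {c})"
  then obtain c where c: "graph T" "card (verts T) = 4" "c \<in> verts T"
    "arcs_ends T = {c} \<times> (verts T - {c}) \<union> (verts T - {c}) \<times> {c}" by auto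
  define W where "W = verts T - {c}"
  have "card W = 3" "verts T = {c} \<union> W" "{c} \<inter> W = {}" "card {c} = 1"
    using c by (auto simp: W_def)
  moreover have "arcs_ends T = {c} \<times> W \<union> W \<times> {c}" using c(4) by (simp only: W_def)
  ultimately show "complete_bipartite_digraph 1 3 T"
    using c(1) unfolding complete_bipartite_digraph_def by blast
qed

text \<open>The last arc of a walk from \<open>c\<close> to another vertex \<open>x\<close> must
  touch \<open>c\<close>, hence starts there; so \<open>c\<close> is adjacent to every other
  vertex.\<close>

lemma star_arcs_ends:
  assumes T: "undirected_tree T" and c: "c \<in> verts T" and star: "star_on (arcs_ends T) (verts T) c"
  shows "arcs_ends T = {c} \<times> (verts T - {c}) \<union> (verts T - {c}) \<times> {c}"
proof -
  interpret graph T using T by (simp add: undirected_tree_def)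
  have conn: "conn_on (arcs_ends T) (verts T)"
    using T connected_iff[OF sym_digraph_axioms] by (simp add: undirected_tree_def)
  have cx: "(c, x) \<in> arcs_ends T" if x: "x \<in> verts T" "x \<noteq> c" for x
  proof -
    have "(c, x) \<in> (Restr (arcs_ends T) (verts T))\<^sup>*" using conn c x by (auto simp: conn_on_def)
    then obtain y where y: "(y, x) \<in> Restr (arcs_ends T) (verts T)"
      by (cases rule: rtranclE) (use x in auto)
    then have "y = c" using star x by (auto simp: star_on_def)
    then show ?thesis using y by auto
  qed
  show ?thesis
  proof (intro equalityI subsetI)
    fix e assume e: "e \<in> arcs_ends T"
    obtain x y where xy: "e = (x, y)" by (cases e)
    have "x \<in> verts T" "y \<in> verts T" "x \<noteq> y"
      using e xy adj_in_verts adj_not_same by auto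
    then show "e \<in> {c} \<times> (verts T - {c}) \<union> (verts T - {c}) \<times> {c}"
      using star e xy by (auto simp: star_on_def)
  next
    fix e assume "e \<in> {c} \<times> (verts T - {c}) \<union> (verts T - {c}) \<times> {c}"
    then show "e \<in> arcs_ends T" using cx graph_symmetric by auto
  qed
qed

text \<open>Along a walk, arcs alternately enter and leave \<open>c\<close>. A closed walk of three
  arcs is thus impossible by parity, and a longer one hits \<open>c\<close> twice among its first
  four heads.\<close>

lemma undirected_tree_star:
  assumes "graph T" and c: "c \<in> verts T"
    and star: "arcs_ends T = {c} \<times> (verts T - {c}) \<union> (verts T - {c}) \<times> {c}"
  shows "undirected_tree T"
proof -
  interpret graph T by fact
  have "conn_on (arcs_ends T) (verts T)"
  proof (rule conn_onI_root)
    show "sym (arcs_ends T)" using sym_arcs by (simp add: symmetric_def)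
    show "(x, c) \<in> (Restr (arcs_ends T) (verts T))\<^sup>*" if "x \<in> verts T" for x
      using that c star by (cases "x = c") auto
  qed (rule c)
  then have "Digraph_Component.connected T" using connected_iff[OF sym_digraph_axioms] c by auto
  moreover have False if cyc: "cycle p" and len: "length p \<ge> 3" for p
  proof -
    obtain e1 e2 e3 p' where p: "p = e1 # e2 # e3 # p'"
      using len by (metis Suc_le_length_iff numeral_3_eq_3)
    obtain u where u: "awalk u p u" "distinct (tl (awalk_verts u p))"
      using cyc by (auto simp: cycle_def)
    have edge: "(tail T e = c) \<noteq> (head T e = c)" if "e \<in> arcs T" for e
    proof -
      have "(tail T e, head T e) \<in> arcs_ends T" using that by (auto simp: arcs_ends_conv)
      then show ?thesis using star by auto
    qed
    have tails: "tail T e1 = u" "tail T e2 = head T e1" "tail T e3 = head T e2"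
      and arcs: "set p \<subseteq> arcs T"
      using u p by (auto simp: awalk_def)
    have alt: "(tail T e1 = c) \<noteq> (head T e1 = c)" "(tail T e2 = c) \<noteq> (head T e2 = c)"
      "(tail T e3 = c) \<noteq> (head T e3 = c)"
      using arcs p edge by auto
    show False
    proof (cases p')
      case Nil
      then show False using u p alt tails by (auto simp: awalk_def)
    next
      case (Cons e4 p'')
      have t4: "tail T e4 = head T e3" using u p Cons by (auto simp: awalk_def)
      have "(tail T e4 = c) \<noteq> (head T e4 = c)" using arcs p Cons edge by auto
      \<comment> \<open>The vertex list of an empty walk still contains its start, so
        \<open>head T e4\<close> is listed even when the cycle has exactly four arcs.\<close>
      moreover have "head T e4 \<in> set (awalk_verts (head T e4) p'')"
        using u p Cons by (cases p'') (auto simp: awalk_def)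
      then have "head T e1 \<noteq> head T e3" "head T e2 \<noteq> head T e4"
        using u p Cons tails t4 by auto
      ultimately show False using alt tails t4 by auto
    qed
  qed
  ultimately show ?thesis using assms(1) by (auto simp: undirected_tree_def)
qed

lemma undirected_treeD:
  assumes "undirected_tree T"
  shows "graph T" "finite (verts T)" "verts T \<noteq> {}" "conn_on (arcs_ends T) (verts T)"
proof -
  show graph: "graph T" using assms by (simp add: undirected_tree_def)
  then have "sym_digraph T" by (simp add: graph_def pseudo_graph_def)
  then show "verts T \<noteq> {}" "conn_on (arcs_ends T) (verts T)"
    using assms connected_iff by (auto simp: undirected_tree_def)
  show "finite (verts T)"
    using graph by (simp add: graph_def digraph_def fin_digraph.finite_verts)
qed

section \<open>Roots on and beyond the boundary circle\<close>

text \<open>One hypothesis covers the circle and its exterior: nonvanishing fails only for the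
  extremal tree, whose definition already pins the modulus to the boundary.\<close>

lemma extremal_root:
  assumes T: "undirected_tree T" and z: "poly (subtree_poly T) z = 0" "1 + root 3 3 \<le> cmod z"
  shows "cmod z = 1 + root 3 3" "complete_bipartite_digraph 1 3 T"
proof -
  have large: "large_modulus (arcs_ends T) z"
    using forest_rel_undirected_tree[OF T] z(2) by (rule large_modulus.intro)
  have "large_modulus.extremal (arcs_ends T) z (verts T)"
    using large_modulus.subtree_sum_ne_0[OF large undirected_treeD(2,4,3)[OF T]]
      poly_subtree_poly[OF undirected_treeD(1)[OF T], of z] z(1) by argo
  then have ext: "cmod z = 1 + root 3 3" "card (verts T) = 4"
    "\<exists>c\<in>verts T. star_on (arcs_ends T) (verts T) c"
    by (simp_all add: large_modulus.extremal_def[OF large])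
  show "cmod z = 1 + root 3 3" by (rule ext)
  show "complete_bipartite_digraph 1 3 T"
    unfolding complete_bipartite_1_3_iff
    using star_arcs_ends[OF T] undirected_treeD(1)[OF T] ext(2,3) by blast
qed

text \<open>The polynomial takes the value \<open>z * ((1 + z) ^ 3 + 3)\<close>, and at the negative
  real point of the boundary circle \<open>(1 + z) ^ 3 = - 3\<close>.\<close>

lemma complete_bipartite_1_3_root:
  assumes "complete_bipartite_digraph 1 3 T"
  shows "undirected_tree T" "poly (subtree_poly T) (- of_real (1 + root 3 3)) = 0"
proof -
  obtain c where c: "graph T" "card (verts T) = 4" "c \<in> verts T"
    "arcs_ends T = {c} \<times> (verts T - {c}) \<union> (verts T - {c}) \<times> {c}"
    using assms unfolding complete_bipartite_1_3_iff by blast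
  have T: "undirected_tree T" by (rule undirected_tree_star[OF c(1,3,4)])
  then show "undirected_tree T" .
  have star: "star_on (arcs_ends T) (verts T) c" unfolding star_on_def c(4) by blast
  define z where "z = - complex_of_real (1 + root 3 3)"
  have "(1 + z) ^ 3 = - complex_of_real (root 3 3 ^ 3)"
    by (simp add: z_def power3_eq_cube)
  then have cube: "(1 + z) ^ 3 = - 3" by simp
  have "poly (subtree_poly T) z = rooted_sum (arcs_ends T) (verts T) c z +
      avoiding_sum (arcs_ends T) (verts T) c z"
    unfolding poly_subtree_poly[OF c(1)] by (rule sum_subtrees[OF undirected_treeD(2)[OF T]])
  also have "\<dots> = z * (1 + z) ^ 3 + 3 * z"
    using star_sums[OF forest_rel_undirected_tree[OF T] undirected_treeD(2,4)[OF T] c(3) star, of z]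
      c(2) by simp
  also have "\<dots> = 0" unfolding cube by simp
  finally show "poly (subtree_poly T) (- of_real (1 + root 3 3)) = 0" by (simp only: z_def)
qed

theorem theorem2p5:
  fixes T :: "('a, 'b) pre_digraph"
  shows "(undirected_tree T \<longrightarrow>
            (\<forall>z. poly (subtree_poly T) z = 0 \<longrightarrow> cmod z \<le> 1 + root 3 3)) \<and>
         (undirected_tree T \<and> (\<exists>z. poly (subtree_poly T) z = 0 \<and> cmod z = 1 + root 3 3)
            \<longleftrightarrow> complete_bipartite_digraph 1 3 T)"
proof (intro conjI impI allI iffI)
  fix z assume "undirected_tree T" "poly (subtree_poly T) z = 0"
  then show "cmod z \<le> 1 + root 3 3" using extremal_root(1)[of T z] by linarith
next
  assume "undirected_tree T \<and> (\<exists>z. poly (subtree_poly T) z = 0 \<and> cmod z = 1 + root 3 3)"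
  then show "complete_bipartite_digraph 1 3 T" using extremal_root(2)[of T] by auto
next
  assume "complete_bipartite_digraph 1 3 T"
  then show "undirected_tree T" by (rule complete_bipartite_1_3_root(1))
next
  assume K: "complete_bipartite_digraph 1 3 T"
  have "cmod (- of_real (1 + root 3 3)) = 1 + root 3 3"
    using root3_bounds by (simp only: norm_minus_cancel norm_of_real)
  then show "\<exists>z. poly (subtree_poly T) z = 0 \<and> cmod z = 1 + root 3 3"
    using complete_bipartite_1_3_root(2)[OF K] by blast
qed

end
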